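(* Let $v\ge2$ be an integer with $\gcd(v,4)\ne2$ and $\gcd(v,18)\ne3$. Then an optimum $(d,2)$-CDA$((d+1)v^2;11,v)$ exists for every positive integer $d$ with $d+1\le v$.
   Context: Consecutive $t$-way interaction in an $N\times k$ array $A=(a_{ij})$ over a $v$-set $V$: $T=\{(i,x_i),\dots,(i+t-1,x_{i+t-1})\}$, $1\le i\le k-t+1$, $x_r\in V$; $\rho(A,T)=\{r: a_{r,j}=x_j\ \forall (j,x_j)\in T\}$, $\rho(A,\mathcal T)=\bigcup_{T\in\mathcal T}\rho(A,T)$. A $(d,t)$-CDA$(N;k,v)$ is an $N\times k$ array over $V$ in which every $t$ consecutive columns contain every $t$-tuple at least once, and such that for every set $\mathcal T$ of exactly $d$ distinct consecutive $t$-way interactions and every consecutive $t$-way interaction $T$: $\rho(A,T)\subseteq\rho(A,\mathcal T)$ iff $T\in\mathcal T$. It is optimum if $N=(d+1)v^t$. *)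

theory Defs
  imports Main
begin

definition is_array :: "(nat \<Rightarrow> nat \<Rightarrow> nat) \<Rightarrow> nat \<Rightarrow> nat \<Rightarrow> nat \<Rightarrow> bool" where
  "is_array A N k v \<longleftrightarrow> (\<forall>r<N. \<forall>c<k. A r c < v)"

definition cons_interactions :: "nat \<Rightarrow> nat \<Rightarrow> nat \<Rightarrow> (nat \<times> nat) set set" where
  "cons_interactions k t v =
     {T. \<exists>i f. i + t \<le> k \<and> (\<forall>j<t. f j < v) \<and> T = {(i + j, f j) | j. j < t}}"

definition rho :: "(nat \<Rightarrow> nat \<Rightarrow> nat) \<Rightarrow> nat \<Rightarrow> (nat \<times> nat) set \<Rightarrow> nat set" where
  "rho A N T = {r. r < N \<and> (\<forall>(j, x) \<in> T. A r j = x)}"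

definition rho_set :: "(nat \<Rightarrow> nat \<Rightarrow> nat) \<Rightarrow> nat \<Rightarrow> (nat \<times> nat) set set \<Rightarrow> nat set" where
  "rho_set A N \<T> = (\<Union>T\<in>\<T>. rho A N T)"

definition is_CDA :: "nat \<Rightarrow> nat \<Rightarrow> (nat \<Rightarrow> nat \<Rightarrow> nat) \<Rightarrow> nat \<Rightarrow> nat \<Rightarrow> nat \<Rightarrow> bool" where
  "is_CDA d t A N k v \<longleftrightarrow>
     is_array A N k v \<and>
     (\<forall>i f. i + t \<le> k \<longrightarrow> (\<forall>j<t. f j < v) \<longrightarrow>
        (\<exists>r<N. \<forall>j<t. A r (i + j) = f j)) \<and>
     (\<forall>\<T>. \<T> \<subseteq> cons_interactions k t v \<longrightarrow> card \<T> = d \<longrightarrow>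
        (\<forall>T \<in> cons_interactions k t v. rho A N T \<subseteq> rho_set A N \<T> \<longleftrightarrow> T \<in> \<T>))"

definition is_optimum_CDA :: "nat \<Rightarrow> nat \<Rightarrow> (nat \<Rightarrow> nat \<Rightarrow> nat) \<Rightarrow> nat \<Rightarrow> nat \<Rightarrow> nat \<Rightarrow> bool" where
  "is_optimum_CDA d t A N k v \<longleftrightarrow> is_CDA d t A N k v \<and> N = (d + 1) * v ^ t"

end

theory Submission
  imports Defs "HOL-Computational_Algebra.Primes"
begin

text \<open>If every consecutive interaction occurs in at least $d+1$ rows and two different ones share at
  most one row, then $d$ interactions cannot cover another one. Index the rows by $(x,y,z)$ and let
  the columns be alternately $x + a_i(z)$ and $y + b_j(z)$ modulo $v$. Two consecutive columns and $z$
  then determine the row, so any $d+1$ values of $z$ may be kept. Interactions share at most one row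
  if, for all $z \ne z'$, the ten pairs $(a_i(z) - a_i(z'), b_j(z) - b_j(z'))$ met when walking along the
  staircase $(a_0,b_0), (a_1,b_0), (a_1,b_1), \ldots$ are distinct modulo $v$. All $a_i$ and $b_j$ are
  fixed integer combinations of $z$ and $\sigma(z)$ for one permutation $\sigma$, and coincidences can only
  come from elements of small order in the integers modulo $v$. These are avoided by the digit reversal
  $\sigma(q + wr) = gq + r$ with $v = gw$.\<close>

section \<open>A criterion for consecutive detecting arrays\<close>

lemma finite_rho: "finite (rho A N T)"
  unfolding rho_def by auto

text \<open>The row sets of \<open>d\<close> interactions other than \<open>T\<close> cut out at
  most \<open>d\<close> rows of \<open>rho A N T\<close> in total, fewer than it has.\<close>

lemma is_CDA_if_meet_at_most_once:
  assumes array: "is_array A N k v"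
    and large: "\<And>T. T \<in> cons_interactions k t v \<Longrightarrow> d < card (rho A N T)"
    and meet: "\<And>T T'. T \<in> cons_interactions k t v \<Longrightarrow> T' \<in> cons_interactions k t v \<Longrightarrow> T \<noteq> T'
      \<Longrightarrow> card (rho A N T \<inter> rho A N T') \<le> 1"
    and "d > 0"
  shows "is_CDA d t A N k v"
  unfolding is_CDA_def
proof (intro conjI allI impI ballI)
  show "is_array A N k v" by (rule array)
next
  fix i f assume i: "i + t \<le> k" and f: "\<forall>j<t. f j < v"
  let ?T = "{(i + j, f j) | j. j < t}"
  have "?T \<in> cons_interactions k t v"
    unfolding cons_interactions_def using i f by blast
  then have "rho A N ?T \<noteq> {}"
    using large by fastforce
  then obtain r where "r \<in> rho A N ?T" by blast
  then have "r < N \<and> (\<forall>j<t. A r (i + j) = f j)"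
    unfolding rho_def by auto
  then show "\<exists>r<N. \<forall>j<t. A r (i + j) = f j" by blast
next
  fix \<T> T
  assume sub: "\<T> \<subseteq> cons_interactions k t v" and card: "card \<T> = d"
    and T: "T \<in> cons_interactions k t v"
  \<comment> \<open>Infinite sets have \<open>card\<close> 0, so \<open>d > 0\<close> excludes
    infinite families.\<close>
  have fin: "finite \<T>"
    using card \<open>d > 0\<close> by (metis card.infinite less_irrefl)
  show "rho A N T \<subseteq> rho_set A N \<T> \<longleftrightarrow> T \<in> \<T>"
  proof
    assume covered: "rho A N T \<subseteq> rho_set A N \<T>"
    show "T \<in> \<T>"
    proof (rule ccontr)
      assume "T \<notin> \<T>"
      have "rho A N T = (\<Union>T'\<in>\<T>. rho A N T \<inter> rho A N T')"
        using covered unfolding rho_set_def by blast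
      then have "card (rho A N T) \<le> (\<Sum>T'\<in>\<T>. card (rho A N T \<inter> rho A N T'))"
        by (metis card_UN_le fin)
      also have "\<dots> \<le> (\<Sum>T'\<in>\<T>. 1)"
        using meet[OF T] sub \<open>T \<notin> \<T>\<close> by (intro sum_mono) blast
      also have "\<dots> = d" using card by simp
      finally show False using large[OF T] by simp
    qed
  next
    assume "T \<in> \<T>"
    then show "rho A N T \<subseteq> rho_set A N \<T>"
      unfolding rho_set_def by blast
  qed
qed

lemma cons_interactions_2E:
  assumes "T \<in> cons_interactions k 2 v"
  obtains n x y where "Suc n < k" "x < v" "y < v" "T = {(n, x), (Suc n, y)}"
proof -
  obtain i f where "i + 2 \<le> k" "\<forall>j<2. f j < v" and T: "T = {(i + j, f j) | j. j < (2::nat)}"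
    using assms unfolding cons_interactions_def by blast
  moreover have "{(i + j, f j) | j. j < (2::nat)} = {(i, f 0), (Suc i, f 1)}"
    by (auto simp: less_2_cases_iff)
  ultimately show thesis
    using that[of i "f 0" "f 1"] by auto
qed

text \<open>The third coordinate cuts the $v^3$ rows into $v$ classes, each of which contains every pair
  in two consecutive columns exactly once; the array consists of $d+1$ of these classes.\<close>

lemma optimum_CDA_if_resolvable:
  fixes L :: "nat \<Rightarrow> nat \<times> nat \<times> nat \<Rightarrow> nat"
  defines "V \<equiv> \<lambda>v. {..<v} \<times> {..<v} \<times> {..<v}"
  assumes range: "\<And>n p. n < k \<Longrightarrow> p \<in> V v \<Longrightarrow> L n p < v"
    and resolvable: "\<And>n. Suc n < k \<Longrightarrow> inj_on (\<lambda>p. (L n p, L (Suc n) p, snd (snd p))) (V v)"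
    and separating: "\<And>m n. m < n \<Longrightarrow> Suc n < k \<Longrightarrow>
      inj_on (\<lambda>p. (L m p, L (Suc m) p, L n p, L (Suc n) p)) (V v)"
    and "d > 0" "d + 1 \<le> v"
  shows "\<exists>A. is_optimum_CDA d 2 A ((d + 1) * v ^ 2) k v"
proof -
  define N where "N = (d + 1) * v ^ 2"
  define R where "R = {..<v} \<times> {..<v} \<times> {..<d + 1}"
  have RV: "R \<subseteq> V v"
    using \<open>d + 1 \<le> v\<close> unfolding R_def V_def by auto
  have "card {..<N} = card R"
    unfolding N_def R_def by (simp add: card_cartesian_product power2_eq_square algebra_simps)
  moreover have "finite R" unfolding R_def by simp
  ultimately obtain h where h: "bij_betw h {..<N} R"
    using finite_same_card_bij[of "{..<N}" R] by blast
  define A where "A = (\<lambda>r c. L c (h r))"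
  have hR: "h r \<in> R" if "r < N" for r
    using h that bij_betwE by blast
  have rho_pair: "rho A N {(n, x), (Suc n, y)} = {r. r < N \<and> L n (h r) = x \<and> L (Suc n) (h r) = y}"
    for n x y unfolding rho_def A_def by auto
  have "is_CDA d 2 A N k v"
  proof (rule is_CDA_if_meet_at_most_once)
    show "is_array A N k v"
      unfolding is_array_def A_def using range hR RV by blast
  next
    fix T assume "T \<in> cons_interactions k 2 v"
    then obtain n x y where n: "Suc n < k" and xy: "x < v" "y < v" and T: "T = {(n, x), (Suc n, y)}"
      by (rule cons_interactions_2E)
    let ?F = "\<lambda>p. (L n p, L (Suc n) p, snd (snd p))"
    \<comment> \<open>An injective self-map of the finite set \<open>V v\<close> is onto, so each
      pair \<open>(x, y)\<close> occurs in every class \<open>z\<close>.\<close>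
    have "?F ` V v \<subseteq> V v"
      using range n by (auto simp: V_def)
    then have surj: "?F ` V v = V v"
      using resolvable[OF n] by (intro endo_inj_surj) (auto simp: V_def)
    have "z \<in> (\<lambda>r. snd (snd (h r))) ` rho A N T" if z: "z < d + 1" for z
    proof -
      have "(x, y, z) \<in> ?F ` V v"
        unfolding surj using xy z \<open>d + 1 \<le> v\<close> by (auto simp: V_def)
      then obtain p where p: "p \<in> V v" and F: "L n p = x" "L (Suc n) p = y" "snd (snd p) = z"
        by auto
      have "p \<in> R" using p F z unfolding V_def R_def by auto
      then obtain r where "r < N" "h r = p"
        using h by (metis bij_betw_imp_surj_on imageE lessThan_iff)
      then show ?thesis
        unfolding T rho_pair using F by (intro image_eqI[of _ _ r]) auto
    qed
    then have "{..<d + 1} \<subseteq> (\<lambda>r. snd (snd (h r))) ` rho A N T" by auto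
    then have "card {..<d + 1} \<le> card (rho A N T)"
      by (rule surj_card_le[OF finite_rho])
    then show "d < card (rho A N T)" by simp
  next
    fix T T' assume "T \<in> cons_interactions k 2 v" "T' \<in> cons_interactions k 2 v" "T \<noteq> T'"
    then obtain m x y n x' y' where mn: "Suc m < k" "Suc n < k"
      and T: "T = {(m, x), (Suc m, y)}" and T': "T' = {(n, x'), (Suc n, y')}"
      by (elim cons_interactions_2E) blast
    have "r = r'" if r: "r \<in> rho A N T \<inter> rho A N T'" and r': "r' \<in> rho A N T \<inter> rho A N T'" for r r'
    proof -
      have rN: "r < N" "r' < N"
        and eq: "L m (h r) = x" "L (Suc m) (h r) = y" "L n (h r) = x'" "L (Suc n) (h r) = y'"
          "L m (h r') = x" "L (Suc m) (h r') = y" "L n (h r') = x'" "L (Suc n) (h r') = y'"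
        using r r' unfolding T T' rho_pair by auto
      \<comment> \<open>Two interactions in the same columns that share a row are equal.\<close>
      have "m \<noteq> n" using eq \<open>T \<noteq> T'\<close> T T' by auto
      then consider "m < n" | "n < m" by linarith
      then have "h r = h r'"
      proof cases
        case 1
        show ?thesis
          by (rule inj_onD[OF separating[OF 1 mn(2)]]) (use eq hR rN RV in auto)
      next
        case 2
        show ?thesis
          by (rule inj_onD[OF separating[OF 2 mn(1)]]) (use eq hR rN RV in auto)
      qed
      then show ?thesis
        using h rN by (meson bij_betw_imp_inj_on inj_onD lessThan_iff)
    qed
    then show "card (rho A N T \<inter> rho A N T') \<le> 1"
      by (metis card_le_Suc0_iff_eq finite_Int finite_rho One_nat_def)
  qed (rule \<open>d > 0\<close>)
  then show ?thesis
    unfolding is_optimum_CDA_def N_def by blast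
qed

section \<open>Staircase arrays\<close>

text \<open>Columns $2i$ and $2j+1$ of the array are $x + a_i(z)$ and $y + b_j(z)$ modulo $v$, so columns
  $n$ and $n+1$ involve the functions with indices $\lceil n/2\rceil$ and $\lfloor n/2\rfloor$.\<close>

definition staircase :: "nat \<Rightarrow> (nat \<Rightarrow> nat \<Rightarrow> int) \<Rightarrow> (nat \<Rightarrow> nat \<Rightarrow> int) \<Rightarrow> bool" where
  "staircase v a b \<longleftrightarrow> (\<forall>n<10. \<forall>m<n. \<forall>z<v. \<forall>z'<v.
     int v dvd (a (Suc n div 2) z - a (Suc n div 2) z') - (a (Suc m div 2) z - a (Suc m div 2) z') \<longrightarrow>
     int v dvd (b (n div 2) z - b (n div 2) z') - (b (m div 2) z - b (m div 2) z') \<longrightarrow>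
     z = z')"

lemma nat_mod_eq_iff_dvd_diff:
  assumes "v > 0"
  shows "nat (i mod int v) = nat (j mod int v) \<longleftrightarrow> int v dvd i - j"
  using assms by (simp add: mod_eq_dvd_iff eq_nat_nat_iff)

lemma eq_if_int_dvd_diff:
  fixes x x' v :: nat
  assumes "x < v" "x' < v" "int v dvd int x - int x'"
  shows "x = x'"
  using assms by (metis mod_eq_dvd_iff mod_less of_nat_eq_iff zmod_int)

lemma coprime_dvd_imp_eq:
  fixes z z' v k :: nat
  assumes "coprime v k" "z < v" "z' < v" "int v dvd int k * (int z - int z')"
  shows "z = z'"
proof -
  have "coprime (int v) (int k)" using assms(1) by simp
  then have "int v dvd int z - int z'"
    using assms(4) coprime_dvd_mult_right_iff by blast
  then show ?thesis using assms(2,3) eq_if_int_dvd_diff by blast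
qed

text \<open>Eleven columns, six with \<open>a\<close> and five with \<open>b\<close>, form ten
  consecutive pairs; hence the bound \<open>n < 10\<close> in \<open>staircase\<close>.\<close>

lemma optimum_CDA_if_staircase:
  assumes "staircase v a b" "d > 0" "d + 1 \<le> v"
  shows "\<exists>A. is_optimum_CDA d 2 A ((d + 1) * v ^ 2) 11 v"
proof -
  define L where "L = (\<lambda>n (x :: nat, y :: nat, z).
    nat ((if even n then int x + a (n div 2) z else int y + b (n div 2) z) mod int v))"
  have "v > 0" using \<open>d + 1 \<le> v\<close> by simp
  \<comment> \<open>For even \<open>n\<close> the \<open>a\<close>-column is \<open>n\<close> and
    the \<open>b\<close>-column \<open>n + 1\<close>; for odd \<open>n\<close> it is the other way
    round. \<open>Suc n div 2\<close> and \<open>n div 2\<close> are the right indices in both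
    cases.\<close>
  have L_eq: "int v dvd (int x - int x') + (a (Suc n div 2) z - a (Suc n div 2) z')
      \<and> int v dvd (int y - int y') + (b (n div 2) z - b (n div 2) z')"
    if "L n (x, y, z) = L n (x', y', z')" "L (Suc n) (x, y, z) = L (Suc n) (x', y', z')"
    for n x y z x' y' z'
  proof (cases "even n")
    case True
    then have "Suc n div 2 = n div 2" by presburger
    then show ?thesis
      using that True by (simp add: L_def nat_mod_eq_iff_dvd_diff[OF \<open>v > 0\<close>] algebra_simps)
  next
    case False
    then show ?thesis
      using that by (simp add: L_def nat_mod_eq_iff_dvd_diff[OF \<open>v > 0\<close>] algebra_simps)
  qed
  have same_class: "(x, y) = (x', y')"
    if "L n (x, y, z) = L n (x', y', z)" "L (Suc n) (x, y, z) = L (Suc n) (x', y', z)"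
      "x < v" "y < v" "x' < v" "y' < v" for n x y z x' y'
    using L_eq[OF that(1,2)] that(3-6) eq_if_int_dvd_diff by auto
  show ?thesis
  proof (rule optimum_CDA_if_resolvable)
    fix n p assume "p \<in> {..<v} \<times> {..<v} \<times> {..<v}"
    then show "L n p < v"
      using \<open>v > 0\<close> by (auto simp: L_def nat_less_iff)
  next
    fix n
    show "inj_on (\<lambda>p. (L n p, L (Suc n) p, snd (snd p))) ({..<v} \<times> {..<v} \<times> {..<v})"
    proof (rule inj_onI, goal_cases)
      case (1 p p')
      then show ?case
        using same_class[of n "fst p" "fst (snd p)" "snd (snd p)" "fst p'" "fst (snd p')"]
        by (cases p; cases p') auto
    qed
  next
    fix m n :: nat assume mn: "m < n" "Suc n < 11"
    show "inj_on (\<lambda>p. (L m p, L (Suc m) p, L n p, L (Suc n) p)) ({..<v} \<times> {..<v} \<times> {..<v})"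
    proof (rule inj_onI)
      fix p p'
      assume "p \<in> {..<v} \<times> {..<v} \<times> {..<v}" "p' \<in> {..<v} \<times> {..<v} \<times> {..<v}"
        and eq: "(L m p, L (Suc m) p, L n p, L (Suc n) p) = (L m p', L (Suc m) p', L n p', L (Suc n) p')"
      then obtain x y z x' y' z' where p: "p = (x, y, z)" "p' = (x', y', z')"
        and V: "x < v" "y < v" "z < v" "x' < v" "y' < v" "z' < v" by auto
      have m: "L m (x, y, z) = L m (x', y', z')" "L (Suc m) (x, y, z) = L (Suc m) (x', y', z')"
        and n: "L n (x, y, z) = L n (x', y', z')" "L (Suc n) (x, y, z) = L (Suc n) (x', y', z')"
        using eq unfolding p by auto
      \<comment> \<open>Subtracting the congruences for \<open>m\<close> from those for
        \<open>n\<close> eliminates \<open>x - x'\<close> and \<open>y - y'\<close>.\<close>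
      have "int v dvd (a (Suc n div 2) z - a (Suc n div 2) z') - (a (Suc m div 2) z - a (Suc m div 2) z')"
        using dvd_diff[of "int v", OF conjunct1[OF L_eq[OF n]] conjunct1[OF L_eq[OF m]]] by simp
      moreover have "int v dvd (b (n div 2) z - b (n div 2) z') - (b (m div 2) z - b (m div 2) z')"
        using dvd_diff[of "int v", OF conjunct2[OF L_eq[OF n]] conjunct2[OF L_eq[OF m]]] by simp
      ultimately have "z = z'"
        using assms(1) mn V unfolding staircase_def by auto
      then show "p = p'"
        using same_class m V unfolding p by blast
    qed
  qed (use assms in auto)
qed

section \<open>Staircases from one permutation\<close>

definition lin :: "(int \<times> int) list \<Rightarrow> (nat \<Rightarrow> nat) \<Rightarrow> nat \<Rightarrow> nat \<Rightarrow> int" where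
  "lin cs \<sigma> i z = fst (cs ! i) * int z + snd (cs ! i) * int (\<sigma> z)"

text \<open>The small range of the coefficients keeps the predicate executable.\<close>

definition combination :: "int \<times> int \<Rightarrow> int \<times> int \<Rightarrow> int \<times> int \<Rightarrow> bool" where
  "combination p q t \<longleftrightarrow> (\<exists>x\<in>set [-2, -1, 0, 1, 2]. \<exists>y\<in>set [-2, -1, 0, 1, 2].
     x * fst p + y * fst q = fst t \<and> x * snd p + y * snd q = snd t)"

text \<open>\<open>P\<close> receives the coefficient vectors, with respect to \<open>z\<close> and
  \<open>\<sigma> z\<close>, of the two differences in \<open>staircase\<close>. Ranging over lists
  makes the 45 pairs of steps checkable by evaluation.\<close>

definition all_steps ::
  "(int \<times> int \<Rightarrow> int \<times> int \<Rightarrow> bool) \<Rightarrow> (int \<times> int) list \<Rightarrow> (int \<times> int) list \<Rightarrow> bool" where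
  "all_steps P as bs \<longleftrightarrow> (\<forall>n\<in>set [0..<10]. \<forall>m\<in>set [0..<n].
     P (fst (as ! (Suc n div 2)) - fst (as ! (Suc m div 2)), snd (as ! (Suc n div 2)) - snd (as ! (Suc m div 2)))
       (fst (bs ! (n div 2)) - fst (bs ! (m div 2)), snd (bs ! (n div 2)) - snd (bs ! (m div 2))))"

lemma dvd_combination:
  assumes "combination p q t" "v dvd fst p * d + snd p * s" "v dvd fst q * d + snd q * s"
  shows "v dvd fst t * d + snd t * s"
proof -
  obtain x y where xy: "x * fst p + y * fst q = fst t" "x * snd p + y * snd q = snd t"
    using assms(1) unfolding combination_def by blast
  have "fst t * d + snd t * s = x * (fst p * d + snd p * s) + y * (fst q * d + snd q * s)"
    by (simp add: algebra_simps flip: xy)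
  then show ?thesis using assms(2,3) by simp
qed

lemma staircase_lin:
  assumes "all_steps P as bs"
    and "\<And>p q z z'. P p q \<Longrightarrow> z < v \<Longrightarrow> z' < v \<Longrightarrow>
      int v dvd fst p * (int z - int z') + snd p * (int (\<sigma> z) - int (\<sigma> z')) \<Longrightarrow>
      int v dvd fst q * (int z - int z') + snd q * (int (\<sigma> z) - int (\<sigma> z')) \<Longrightarrow> z = z'"
  shows "staircase v (lin as \<sigma>) (lin bs \<sigma>)"
  unfolding staircase_def
proof (intro allI impI)
  fix n m z z' :: nat
  assume "n < 10" "m < n" and z: "z < v" "z' < v"
    and "int v dvd (lin as \<sigma> (Suc n div 2) z - lin as \<sigma> (Suc n div 2) z')
      - (lin as \<sigma> (Suc m div 2) z - lin as \<sigma> (Suc m div 2) z')"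
    and "int v dvd (lin bs \<sigma> (n div 2) z - lin bs \<sigma> (n div 2) z')
      - (lin bs \<sigma> (m div 2) z - lin bs \<sigma> (m div 2) z')"
  moreover have "P (fst (as ! (Suc n div 2)) - fst (as ! (Suc m div 2)), snd (as ! (Suc n div 2)) - snd (as ! (Suc m div 2)))
       (fst (bs ! (n div 2)) - fst (bs ! (m div 2)), snd (bs ! (n div 2)) - snd (bs ! (m div 2)))"
    using assms(1) \<open>n < 10\<close> \<open>m < n\<close> unfolding all_steps_def by auto
  ultimately show "z = z'"
    by (intro assms(2)[OF _ z]) (auto simp: lin_def algebra_simps)
qed

text \<open>The coefficient lists of the next two lemmas were found by computer search. Each lists the only
  relations between $d = z - z'$ and $s = \sigma(z) - \sigma(z')$ modulo $v$ that make two steps of the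
  staircase coincide.\<close>

lemma staircase_generic:
  assumes inj: "inj_on \<sigma> {..<v}" "\<And>z. z < v \<Longrightarrow> \<sigma> z < v"
    and two: "\<And>z z'. z < v \<Longrightarrow> z' < v \<Longrightarrow> int v dvd 2 * (int z - int z') \<Longrightarrow>
      int v dvd 4 * (int (\<sigma> z) - int (\<sigma> z')) \<Longrightarrow> z = z'"
    and three: "\<And>z z'. z < v \<Longrightarrow> z' < v \<Longrightarrow> int v dvd 3 * (int z - int z') \<Longrightarrow>
      int v dvd 3 * (int (\<sigma> z) - int (\<sigma> z')) \<Longrightarrow> z = z'"
  shows "\<exists>a b. staircase v a b"
proof (intro exI, rule staircase_lin)
  show "all_steps (\<lambda>p q. combination p q (1, 0) \<or> combination p q (0, 1) \<or>
      combination p q (2, 0) \<and> combination p q (0, 4) \<or> combination p q (3, 0) \<and> combination p q (0, 3))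
    [(0,0), (1,0), (1,1), (1,2), (0,2), (0,1)] [(0,0), (0,-1), (1,-1), (1,0), (1,1)]"
    unfolding all_steps_def combination_def by code_simp
next
  fix p q z z'
  assume P: "combination p q (1, 0) \<or> combination p q (0, 1) \<or>
      combination p q (2, 0) \<and> combination p q (0, 4) \<or> combination p q (3, 0) \<and> combination p q (0, 3)"
    and z: "z < v" "z' < v"
    and "int v dvd fst p * (int z - int z') + snd p * (int (\<sigma> z) - int (\<sigma> z'))"
      "int v dvd fst q * (int z - int z') + snd q * (int (\<sigma> z) - int (\<sigma> z'))"
  \<comment> \<open>\<open>this(4,5)\<close> are the two assumed congruences; each vector that
    \<open>combination\<close> finds from \<open>p\<close> and \<open>q\<close> yields a further
    congruence between the differences of \<open>z\<close> and of \<open>\<sigma> z\<close>.\<close>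
  note hit = dvd_combination[OF _ this(4,5)]
  show "z = z'"
    using P
  proof (elim disjE conjE)
    assume "combination p q (1, 0)"
    from hit[OF this] show ?thesis using z eq_if_int_dvd_diff by simp
  next
    assume "combination p q (0, 1)"
    from hit[OF this] have "\<sigma> z = \<sigma> z'"
      by (intro eq_if_int_dvd_diff[OF inj(2)[OF z(1)] inj(2)[OF z(2)]]) simp
    then show ?thesis using inj(1) z by (simp add: inj_on_def)
  next
    assume "combination p q (2, 0)" "combination p q (0, 4)"
    from this[THEN hit] show ?thesis using two z by simp
  next
    assume "combination p q (3, 0)" "combination p q (0, 3)"
    from this[THEN hit] show ?thesis using three z by simp
  qed
qed

lemma staircase_not_5_dvd:
  assumes inj: "inj_on \<sigma> {..<v}" "\<And>z. z < v \<Longrightarrow> \<sigma> z < v"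
    and two: "\<And>z z'. z < v \<Longrightarrow> z' < v \<Longrightarrow> int v dvd 2 * (int z - int z') \<Longrightarrow>
      int v dvd (int z - int z') + (int (\<sigma> z) - int (\<sigma> z')) \<Longrightarrow> z = z'"
    and three: "\<And>z z'. z < v \<Longrightarrow> z' < v \<Longrightarrow> int v dvd 3 * (int z - int z') \<Longrightarrow>
      int v dvd 3 * (int (\<sigma> z) - int (\<sigma> z')) \<Longrightarrow> z = z'"
    and five: "coprime v 5"
  shows "\<exists>a b. staircase v a b"
proof (intro exI, rule staircase_lin)
  show "all_steps (\<lambda>p q. combination p q (1, 0) \<or> combination p q (0, 1) \<or> combination p q (5, 0) \<or>
      combination p q (2, 0) \<and> combination p q (1, 1) \<or> combination p q (3, 0) \<and> combination p q (0, 3))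
    [(0,0), (1,0), (2,0), (2,1), (1,1), (0,1)] [(0,0), (-1,0), (-1,1), (-1,2), (0,2)]"
    unfolding all_steps_def combination_def by code_simp
next
  fix p q z z'
  assume P: "combination p q (1, 0) \<or> combination p q (0, 1) \<or> combination p q (5, 0) \<or>
      combination p q (2, 0) \<and> combination p q (1, 1) \<or> combination p q (3, 0) \<and> combination p q (0, 3)"
    and z: "z < v" "z' < v"
    and "int v dvd fst p * (int z - int z') + snd p * (int (\<sigma> z) - int (\<sigma> z'))"
      "int v dvd fst q * (int z - int z') + snd q * (int (\<sigma> z) - int (\<sigma> z'))"
  note hit = dvd_combination[OF _ this(4,5)]
  show "z = z'"
    using P
  proof (elim disjE conjE)
    assume "combination p q (1, 0)"
    from hit[OF this] show ?thesis using z eq_if_int_dvd_diff by simp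
  next
    assume "combination p q (0, 1)"
    from hit[OF this] have "\<sigma> z = \<sigma> z'"
      by (intro eq_if_int_dvd_diff[OF inj(2)[OF z(1)] inj(2)[OF z(2)]]) simp
    then show ?thesis using inj(1) z by (simp add: inj_on_def)
  next
    assume "combination p q (5, 0)"
    from hit[OF this] have "int v dvd int 5 * (int z - int z')" by simp
    then show ?thesis by (rule coprime_dvd_imp_eq[OF five z])
  next
    assume "combination p q (2, 0)" "combination p q (1, 1)"
    from this[THEN hit] show ?thesis using two z by simp
  next
    assume "combination p q (3, 0)" "combination p q (0, 3)"
    from this[THEN hit] show ?thesis using three z by simp
  qed
qed

section \<open>Digit reversal\<close>

definition digit_reversal :: "nat \<Rightarrow> nat \<Rightarrow> nat \<Rightarrow> nat" where
  "digit_reversal g w z = g * (z mod w) + z div w"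

lemma digit_reversal_less:
  assumes "z < g * w"
  shows "digit_reversal g w z < g * w"
proof -
  have "w > 0" using assms by (cases w) auto
  then have "z div w < g" "Suc (z mod w) \<le> w"
    using assms by (auto simp: less_mult_imp_div_less Suc_le_eq)
  then have "digit_reversal g w z < g * Suc (z mod w)"
    unfolding digit_reversal_def by simp
  also have "\<dots> \<le> g * w"
    using \<open>Suc (z mod w) \<le> w\<close> by (rule mult_le_mono2)
  finally show ?thesis .
qed

lemma inj_on_digit_reversal: "inj_on (digit_reversal g w) {..<g * w}"
proof (rule inj_onI)
  fix z z' assume z: "z \<in> {..<g * w}" "z' \<in> {..<g * w}"
    and eq: "digit_reversal g w z = digit_reversal g w z'"
  have less: "z div w < g" "z' div w < g"
    using z by (auto simp: less_mult_imp_div_less)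
  then have "digit_reversal g w z div g = z mod w" "digit_reversal g w z mod g = z div w"
    "digit_reversal g w z' div g = z' mod w" "digit_reversal g w z' mod g = z' div w"
    by (auto simp: digit_reversal_def)
  then show "z = z'"
    using eq by (metis mult_div_mod_eq)
qed

text \<open>If \<open>z - z'\<close> is killed by \<open>k\<close> modulo \<open>k * h * w\<close>,
  it is a multiple of \<open>h * w\<close>. So the low digits agree and only the high digits, both
  below \<open>k * h\<close>, differ, by \<open>h * e\<close>. The reversal turns this into a
  difference of only \<open>h * e\<close>, and \<open>k\<close> times that vanishes modulo
  \<open>k * h * w\<close> only if \<open>w\<close> divides \<open>e\<close>.\<close>

lemma digit_reversal_diff:
  assumes z: "z < k * h * w" "z' < k * h * w"
    and dvd: "int (k * h * w) dvd int k * (int z - int z')"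
  obtains e where "int z - int z' = int (h * w) * e"
    "int (digit_reversal (k * h) w z) - int (digit_reversal (k * h) w z') = int h * e"
    "\<bar>e\<bar> < int k"
proof -
  have pos: "k > 0" "h > 0" "w > 0" using z by (auto intro!: gr0I)
  have "int (h * w) dvd int z - int z'"
    using dvd pos by (simp add: mult.assoc)
  then obtain e where e: "int z - int z' = int (h * w) * e" by (elim dvdE)
  then have "int w dvd int z - int z'" by simp
  then have m: "z mod w = z' mod w"
    by (metis mod_eq_dvd_iff of_nat_eq_iff zmod_int)
  have "int z = int w * int (z div w) + int (z mod w)" "int z' = int w * int (z' div w) + int (z' mod w)"
    by (metis mult_div_mod_eq of_nat_add of_nat_mult)+
  then have "int w * (int (z div w) - int (z' div w)) = int w * (int h * e)"
    using e m by (simp add: algebra_simps)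
  then have r: "int (z div w) - int (z' div w) = int h * e"
    using pos by simp
  have "z div w < k * h" "z' div w < k * h"
    using z by (auto simp: less_mult_imp_div_less)
  then have "\<bar>int (z div w) - int (z' div w)\<bar> < int (k * h)" by linarith
  then have "int h * \<bar>e\<bar> < int h * int k"
    unfolding r by (simp add: abs_mult mult.commute)
  then have "\<bar>e\<bar> < int k" using pos by simp
  moreover have "int (digit_reversal (k * h) w z) - int (digit_reversal (k * h) w z') = int h * e"
    unfolding digit_reversal_def m using r by simp
  ultimately show thesis using that e by blast
qed

text \<open>A factor 2 or 3 prime to \<open>g * w\<close> cancels. Otherwise it divides
  \<open>g\<close>, and \<open>digit_reversal_diff\<close> leaves \<open>w\<close> dividing
  \<open>2 * e\<close> with \<open>\<bar>e\<bar> < 2\<close>, or \<open>e\<close> with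
  \<open>\<bar>e\<bar> < 3\<close>. Either number has absolute value at most 2, so
  \<open>w \<ge> 3\<close> forces \<open>e = 0\<close>.\<close>

lemma exists_staircase_if_large:
  fixes g w :: nat
  assumes w: "w \<ge> 3" and g: "even (g * w) \<Longrightarrow> even g" "3 dvd g * w \<Longrightarrow> 3 dvd g"
  shows "\<exists>a b. staircase (g * w) a b"
proof (rule staircase_generic[OF inj_on_digit_reversal digit_reversal_less])
  fix z z'
  assume z: "z < g * w" "z' < g * w" and d: "int (g * w) dvd 2 * (int z - int z')"
    and s: "int (g * w) dvd 4 * (int (digit_reversal g w z) - int (digit_reversal g w z'))"
  show "z = z'"
  proof (cases "even g")
    case True
    then obtain h where h: "g = 2 * h" by blast
    obtain e where e: "int z - int z' = int (h * w) * e" "\<bar>e\<bar> < 2"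
      "int (digit_reversal g w z) - int (digit_reversal g w z') = int h * e"
      using digit_reversal_diff[of z 2 h w z'] z d unfolding h by auto
    have "h > 0" using z h by (auto intro!: gr0I)
    have "int (2 * h) * int w dvd int (2 * h) * (2 * e)"
      using s unfolding e(3) by (simp add: h algebra_simps)
    then have "int w dvd 2 * e" using \<open>h > 0\<close> by (subst (asm) dvd_times_left_cancel_iff) auto
    moreover have "\<bar>2 * e\<bar> < int w" using e(2) w by linarith
    ultimately have "e = 0" using zdvd_not_zless[of "\<bar>2 * e\<bar>" "int w"] by auto
    then show ?thesis using e(1) by simp
  next
    case False
    then have "coprime (g * w) 2" using g(1) coprime_right_2_iff_odd by blast
    then show ?thesis using coprime_dvd_imp_eq z d by fastforce
  qed
next
  fix z z'
  assume z: "z < g * w" "z' < g * w" and d: "int (g * w) dvd 3 * (int z - int z')"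
    and s: "int (g * w) dvd 3 * (int (digit_reversal g w z) - int (digit_reversal g w z'))"
  show "z = z'"
  proof (cases "3 dvd g")
    case True
    then obtain h where h: "g = 3 * h" by blast
    obtain e where e: "int z - int z' = int (h * w) * e" "\<bar>e\<bar> < 3"
      "int (digit_reversal g w z) - int (digit_reversal g w z') = int h * e"
      using digit_reversal_diff[of z 3 h w z'] z d unfolding h by auto
    have "h > 0" using z h by (auto intro!: gr0I)
    have "int (3 * h) * int w dvd int (3 * h) * e"
      using s unfolding e(3) by (simp add: h algebra_simps)
    then have "int w dvd e" using \<open>h > 0\<close> by (subst (asm) dvd_times_left_cancel_iff) auto
    moreover have "\<bar>e\<bar> < int w" using e(2) w by linarith
    ultimately have "e = 0" using zdvd_not_zless[of "\<bar>e\<bar>" "int w"] by auto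
    then show ?thesis using e(1) by simp
  next
    case False
    then have "coprime (g * w) 3"
      using g(2) prime_imp_coprime[of 3 "g * w"] by (auto simp: coprime_commute)
    then show ?thesis using coprime_dvd_imp_eq z d by fastforce
  qed
qed

text \<open>Meant for the orders 4 and 12, where no factorization satisfies
  \<open>exists_staircase_if_large\<close>. Modulo 4 the relation \<open>4 * s = 0\<close> is
  vacuous, so \<open>staircase_generic\<close> cannot apply there with any permutation. Quantifying
  over lists lets evaluation discharge the hypotheses.\<close>

lemma exists_staircase_if_not_5_dvd:
  fixes g w :: nat
  assumes two: "\<forall>z\<in>set [0..<g * w]. \<forall>z'\<in>set [0..<g * w]. int (g * w) dvd 2 * (int z - int z') \<longrightarrow>
      int (g * w) dvd (int z - int z') + (int (digit_reversal g w z) - int (digit_reversal g w z')) \<longrightarrow> z = z'"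
    and three: "\<forall>z\<in>set [0..<g * w]. \<forall>z'\<in>set [0..<g * w]. int (g * w) dvd 3 * (int z - int z') \<longrightarrow>
      int (g * w) dvd 3 * (int (digit_reversal g w z) - int (digit_reversal g w z')) \<longrightarrow> z = z'"
    and five: "coprime (g * w) 5"
  shows "\<exists>a b. staircase (g * w) a b"
proof (rule staircase_not_5_dvd[OF inj_on_digit_reversal digit_reversal_less _ _ five])
  fix z z' assume "z < g * w" "z' < g * w"
  then have z: "z \<in> set [0..<g * w]" "z' \<in> set [0..<g * w]" by simp_all
  note two[rule_format, OF z]
  then show "int (g * w) dvd 2 * (int z - int z') \<Longrightarrow>
    int (g * w) dvd (int z - int z') + (int (digit_reversal g w z) - int (digit_reversal g w z')) \<Longrightarrow> z = z'" .
  note three[rule_format, OF z]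
  then show "int (g * w) dvd 3 * (int z - int z') \<Longrightarrow>
    int (g * w) dvd 3 * (int (digit_reversal g w z) - int (digit_reversal g w z')) \<Longrightarrow> z = z'" .
qed

section \<open>The exceptional orders 4 and 12\<close>

lemma exists_staircase_4: "\<exists>a b. staircase 4 a b"
proof -
  have "\<exists>a b. staircase (2 * 2) a b"
    by (rule exists_staircase_if_not_5_dvd) code_simp+
  then show ?thesis by simp
qed

lemma exists_staircase_12: "\<exists>a b. staircase 12 a b"
proof -
  \<comment> \<open>Here \<open>g\<close> is odd. Adding 6 changes both base-4 digits, and the sum
    of the two differences is 13 or 2, hence nonzero modulo 12.\<close>
  have "\<exists>a b. staircase (3 * 4) a b"
    by (rule exists_staircase_if_not_5_dvd) code_simp+
  then show ?thesis by simp
qed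

section \<open>Choice of the factorization of \<open>v\<close>\<close>

theorem mainTheorem11:
  fixes v d :: nat
  assumes "v \<ge> 2" and "gcd v 4 \<noteq> 2" and "gcd v 18 \<noteq> 3"
    and "d > 0" and "d + 1 \<le> v"
  shows "\<exists>A. is_optimum_CDA d 2 A ((d + 1) * v ^ 2) 11 v"
proof -
  \<comment> \<open>The gcd conditions become residue conditions: an even \<open>v\<close> is a
    multiple of 4, and an odd multiple of 3 is a multiple of 9.\<close>
  have mod4: "v mod 4 \<noteq> 2"
  proof
    assume "v mod 4 = 2"
    then have "gcd v 4 = gcd 4 2" using gcd_red_nat[of v 4] by (simp only:)
    then show False using assms(2) by (simp add: gcd_non_0_nat)
  qed
  have mod18: "v mod 18 \<noteq> 3" "v mod 18 \<noteq> 15"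
  proof safe
    assume "v mod 18 = 3"
    then have "gcd v 18 = gcd 18 3" using gcd_red_nat[of v 18] by (simp only:)
    then show False using assms(3) by (simp add: gcd_non_0_nat)
  next
    assume "v mod 18 = 15"
    then have "gcd v 18 = gcd 18 15" using gcd_red_nat[of v 18] by (simp only:)
    then show False using assms(3) by (simp add: gcd_non_0_nat)
  qed
  \<comment> \<open>Let \<open>g\<close> take one factor 2 and one factor 3, as far as they divide
    \<open>v\<close>, and \<open>w\<close> the rest: \<open>6 * (2 * u)\<close>,
    \<open>2 * (2 * u)\<close>, \<open>3 * (3 * u)\<close> or \<open>1 * v\<close>. Then
    \<open>w < 3\<close> only for \<open>u = 1\<close> in the first two forms, which gives 12 and
    4.\<close>
  consider "v = 4" | "v = 12" | g w where "v = g * w" "w \<ge> 3" "even v \<longrightarrow> even g" "3 dvd v \<longrightarrow> 3 dvd g"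
  proof (cases "even v")
    case True
    then have "4 dvd v" using mod4 by presburger
    show thesis
    proof (cases "3 dvd v")
      case True
      then have "12 dvd v" using \<open>4 dvd v\<close> by presburger
      then obtain u where "v = 12 * u" by blast
      then show thesis
        using that(2) that(3)[of 6 "2 * u"] \<open>v \<ge> 2\<close> by (cases "u \<le> 1") (auto simp: le_Suc_eq)
    next
      case False
      obtain u where "v = 4 * u" using \<open>4 dvd v\<close> by blast
      then show thesis
        using that(1) that(3)[of 2 "2 * u"] False \<open>v \<ge> 2\<close> by (cases "u \<le> 1") (auto simp: le_Suc_eq)
    qed
  next
    case odd: False
    show thesis
    proof (cases "3 dvd v")
      case True
      then have "9 dvd v" using odd mod18 by presburger
      then obtain u where "v = 9 * u" by blast
      then show thesis
        using that(3)[of 3 "3 * u"] odd \<open>v \<ge> 2\<close> by auto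
    next
      case False
      then show thesis
        using that(3)[of 1 v] odd \<open>v \<ge> 2\<close> by (cases "v = 2") auto
    qed
  qed
  then have "\<exists>a b. staircase v a b"
  proof cases
    case (3 g w)
    then show ?thesis using exists_staircase_if_large[of w g] by blast
  qed (simp_all add: exists_staircase_4 exists_staircase_12)
  then show ?thesis
    using optimum_CDA_if_staircase assms(4,5) by blast
qed

end
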